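(* Let $D=(V,A)$ be a semicomplete multipartite digraph such that $\alpha(D)\leq 2$. Then $D$ is unilaterally connected if and only if $D$ contains a Hamiltonian path.
   Context: All digraphs are finite and simple: no loops and no parallel arcs, but both arcs $vw$ and $wv$ may be present. A semicomplete multipartite digraph is a digraph $D$ whose vertex set is partitioned into color classes $V_1,\dots,V_c$ such that, for every pair of distinct vertices, there is at least one arc between them if and only if they lie in different color classes. The independence number $\alpha(D)$ is that of the underlying undirected graph; here $\alpha(D)=\max_i|V_i|$. A digraph is unilaterally connected if for every pair of distinct vertices $x,y$ it contains a directed path from $x$ to $y$ or a directed path from $y$ to $x$. A Hamiltonian path is a directed path containing all vertices. *)

theory Defs
  imports "Graph_Theory.Digraph_Component" "HOL-Library.Disjoint_Sets"
begin

text \<open>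
  The locale predicate \<^const>\<open>digraph\<close> says: finite, without loops, without parallel arcs;
  a pair of opposite arcs is allowed.  A path is an \<open>apath\<close>: its endpoints and its list of arcs.
\<close>

text \<open>The members of the partition \<open>P\<close> are the color classes; they are nonempty.\<close>

definition semicomplete_multipartite :: "('a,'b) pre_digraph \<Rightarrow> bool" where
  "semicomplete_multipartite D \<longleftrightarrow> digraph D \<and>
     (\<exists>P. partition_on (verts D) P \<and>
       (\<forall>u\<in>verts D. \<forall>v\<in>verts D. u \<noteq> v \<longrightarrow>
         ((u \<rightarrow>\<^bsub>D\<^esub> v \<or> v \<rightarrow>\<^bsub>D\<^esub> u) \<longleftrightarrow>
          (\<exists>V\<in>P. \<exists>W\<in>P. V \<noteq> W \<and> u \<in> V \<and> v \<in> W))))"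

definition independent_set :: "('a,'b) pre_digraph \<Rightarrow> 'a set \<Rightarrow> bool" where
  "independent_set G S \<longleftrightarrow>
     S \<subseteq> verts G \<and> (\<forall>u\<in>S. \<forall>v\<in>S. u \<noteq> v \<longrightarrow> \<not> u \<rightarrow>\<^bsub>G\<^esub> v)"

text \<open>\<^const>\<open>mk_symmetric\<close> is the underlying undirected graph.\<close>

definition independence_number :: "('a,'b) pre_digraph \<Rightarrow> nat" where
  "independence_number D =
     Max (card ` {S. independent_set (with_proj (mk_symmetric D)) S})"

text \<open>
  As for \<^const>\<open>strongly_connected\<close> and \<^const>\<open>connected\<close>, the null digraph is excluded;
  it has no Hamiltonian path either, since every \<open>apath\<close> has at least one vertex.
\<close>

definition unilaterally_connected :: "('a,'b) pre_digraph \<Rightarrow> bool" where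
  "unilaterally_connected D \<longleftrightarrow> verts D \<noteq> {} \<and>
     (\<forall>x\<in>verts D. \<forall>y\<in>verts D. x \<noteq> y \<longrightarrow>
       (\<exists>p. pre_digraph.apath D x p y) \<or> (\<exists>p. pre_digraph.apath D y p x))"

definition hamiltonian_path :: "('a,'b) pre_digraph \<Rightarrow> 'a \<Rightarrow> 'b awalk \<Rightarrow> 'a \<Rightarrow> bool" where
  "hamiltonian_path D u p v \<longleftrightarrow>
     pre_digraph.apath D u p v \<and> set (pre_digraph.awalk_verts D u p) = verts D"

end

theory Submission
  imports Defs
begin

text \<open>
  A Hamiltonian path visits any two vertices one after the other, so it witnesses unilateral
  connectedness.  For the converse, the property that matters is that a vertex has at most one
  non-neighbor, which is what color classes with at most two members give.

  Take a longest path \<open>xs @ y # zs\<close> and a vertex \<open>v\<close> off it.  If \<open>v\<close> were adjacent to the whole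
  path, it could be inserted somewhere; so it has a non-neighbor on the path, say \<open>y\<close>.  As \<open>v\<close>
  cannot be inserted next to a vertex of \<open>xs\<close> or \<open>zs\<close>, every arc between \<open>xs\<close> and \<open>v\<close> enters \<open>v\<close>,
  and every arc between \<open>v\<close> and \<open>zs\<close> leaves \<open>v\<close> (\<open>twin_arcs\<close>).  Therefore \<open>v\<close> may take the place
  of \<open>y\<close>, and \<open>y\<close>, now off a longest path, behaves like \<open>v\<close>.  An arc from \<open>zs\<close> back to \<open>xs\<close>
  would allow a longer path that meets \<open>v\<close> before this arc and \<open>y\<close> after it
  (\<open>no_arc_back_over_twins\<close>).  Every other vertex off the path can likewise be exchanged with its
  own non-neighbor, so these statements extend from the path to all vertices
  (\<open>exchange_onto_path\<close>): the out-neighborhood of \<open>v\<close> is closed under taking out-neighbors,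
  and it does not contain \<open>y\<close>.  Hence \<open>y\<close> is not reachable from \<open>v\<close> and, exchanging
  the two, \<open>v\<close> is not reachable from \<open>y\<close>.  In a unilaterally connected digraph a longest path
  therefore covers all vertices.
\<close>

(* The arrow denotes arcs of a digraph throughout, not function sets. *)
unbundle no funcset_syntax

section \<open>Inserting a vertex into a sequence\<close>

text \<open>
  The earliest element that \<open>v\<close> precedes would be a place for inserting \<open>v\<close>, since \<open>v\<close> must
  follow the element before it.
\<close>

lemma not_insertable_before:
  assumes "successively E xs"
    and adj: "\<forall>x\<in>set xs. E v x \<or> E x v"
    and no_insertion: "\<And>as x bs. xs = as @ x # bs \<Longrightarrow> \<not> successively E (as @ v # x # bs)"
    and "x \<in> set xs"
  shows "\<not> E v x"
proof -
  have "\<not> E v x" if "xs = as @ x # bs" for as x bs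
    using that
  proof (induction as arbitrary: x bs rule: rev_induct)
    case Nil
    then show ?case
      using no_insertion[of "[]" x bs] \<open>successively E xs\<close> by auto
  next
    case (snoc a as)
    have "\<not> E v a" using snoc.IH[of a "x # bs"] snoc.prems by simp
    then have "E a v" using adj snoc.prems by auto
    then show ?case
      using no_insertion[OF snoc.prems] \<open>successively E xs\<close> snoc.prems
      by (auto simp: successively_append_iff)
  qed
  then show ?thesis using \<open>x \<in> set xs\<close> by (meson split_list)
qed

lemma not_insertable_after:
  assumes "successively E xs"
    and "\<forall>x\<in>set xs. E v x \<or> E x v"
    and no_insertion: "\<And>as x bs. xs = as @ x # bs \<Longrightarrow> \<not> successively E (as @ x # v # bs)"
    and "x \<in> set xs"
  shows "\<not> E x v"
proof (rule not_insertable_before[where E = "\<lambda>a b. E b a" and xs = "rev xs"])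
  fix as a bs
  assume "rev xs = as @ a # bs"
  then have "xs = rev bs @ a # rev as"
    by (simp add: rev_eq_append_conv)
  from no_insertion[OF this] have "\<not> successively E (rev (as @ v # a # bs))" by simp
  then show "\<not> successively (\<lambda>a b. E b a) (as @ v # a # bs)"
    unfolding successively_rev .
qed (use assms in auto)

section \<open>Longest paths when non-neighbors are unique\<close>

locale unique_nonneighbor_digraph = digraph +
  assumes unique_nonneighbor:
    "\<lbrakk>x \<in> verts G; y \<in> verts G; z \<in> verts G; x \<noteq> y; x \<noteq> z; y \<noteq> z\<rbrakk>
      \<Longrightarrow> (x \<rightarrow> y \<or> y \<rightarrow> x) \<or> (x \<rightarrow> z \<or> z \<rightarrow> x)"
begin

definition dipath :: "'a list \<Rightarrow> bool" where
  "dipath xs \<longleftrightarrow> distinct xs \<and> set xs \<subseteq> verts G \<and> successively (\<lambda>u v. u \<rightarrow> v) xs"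

definition longest_dipath :: "'a list \<Rightarrow> bool" where
  "longest_dipath xs \<longleftrightarrow> dipath xs \<and> (\<forall>ys. dipath ys \<longrightarrow> length ys \<le> length xs)"

lemma longest_dipath_exists: "\<exists>xs. longest_dipath xs"
proof -
  have "length xs < Suc (card (verts G))" if "dipath xs" for xs
    using that unfolding dipath_def
    by (metis card_mono distinct_card finite_verts le_imp_less_Suc)
  moreover have "dipath []" by (simp add: dipath_def)
  ultimately show ?thesis
    using ex_has_greatest_nat[of dipath "[]" length "Suc (card (verts G))"]
    unfolding longest_dipath_def by blast
qed

lemma longest_dipath_maximal:
  assumes "longest_dipath xs" "length ys = Suc (length xs)"
  shows "\<not> dipath ys"
proof
  assume "dipath ys"
  then have "length ys \<le> length xs" using assms(1) unfolding longest_dipath_def by blast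
  with assms(2) show False by simp
qed

lemma ex_nonneighbor_on_longest_dipath:
  assumes longest: "longest_dipath xs" and v: "v \<in> verts G" "v \<notin> set xs"
  shows "\<exists>y\<in>set xs. \<not> (v \<rightarrow> y \<or> y \<rightarrow> v)"
proof (rule ccontr)
  assume "\<not> ?thesis"
  then have adj: "\<forall>x\<in>set xs. v \<rightarrow> x \<or> x \<rightarrow> v" by blast
  have path: "distinct xs" "set xs \<subseteq> verts G" "successively (\<lambda>u v. u \<rightarrow> v) xs"
    using longest by (auto simp: longest_dipath_def dipath_def)
  have "\<not> v \<rightarrow> x" if "x \<in> set xs" for x
  proof (rule not_insertable_before[where E = "dominates G", OF path(3) adj _ that])
    fix as a bs
    assume "xs = as @ a # bs"
    then show "\<not> successively (\<lambda>u v. u \<rightarrow> v) (as @ v # a # bs)"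
      using longest_dipath_maximal[OF longest, of "as @ v # a # bs"] path v
      by (auto simp: dipath_def)
  qed
  with adj have "\<forall>x\<in>set xs. x \<rightarrow> v" by blast
  then have "dipath (xs @ [v])"
    using path v by (cases "xs = []") (simp_all add: dipath_def successively_append_iff)
  then show False using longest_dipath_maximal[OF longest, of "xs @ [v]"] by simp
qed

text \<open>
  A vertex off a longest path and its non-neighbor on the path are called twins here.  The arcs
  between \<open>v\<close> and the path all point in the direction that makes \<open>v\<close> a substitute for its twin.
\<close>

lemma twin_arcs:
  assumes longest: "longest_dipath (xs @ y # zs)"
    and v: "v \<in> verts G" "v \<notin> set (xs @ y # zs)"
    and nonadj: "\<not> (v \<rightarrow> y \<or> y \<rightarrow> v)"
  shows "x \<in> set xs \<Longrightarrow> x \<rightarrow> v \<and> \<not> v \<rightarrow> x"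
    and "z \<in> set zs \<Longrightarrow> v \<rightarrow> z \<and> \<not> z \<rightarrow> v"
proof -
  have path: "distinct (xs @ y # zs)" "set (xs @ y # zs) \<subseteq> verts G"
      "successively (\<lambda>u v. u \<rightarrow> v) (xs @ y # zs)"
    using longest by (auto simp: longest_dipath_def dipath_def)
  have adj: "\<forall>x\<in>set xs. v \<rightarrow> x \<or> x \<rightarrow> v" "\<forall>z\<in>set zs. v \<rightarrow> z \<or> z \<rightarrow> v"
    using unique_nonneighbor[of v y] nonadj v path(1,2) by auto
  have parts: "successively (\<lambda>u v. u \<rightarrow> v) xs" "successively (\<lambda>u v. u \<rightarrow> v) zs"
    using path(3) by (auto simp: successively_append_iff successively_Cons)
  show "x \<rightarrow> v \<and> \<not> v \<rightarrow> x" if x: "x \<in> set xs"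
  proof -
    have "\<not> v \<rightarrow> x"
    proof (rule not_insertable_before[where E = "dominates G", OF parts(1) adj(1) _ x])
      fix as a bs
      assume xs: "xs = as @ a # bs"
      show "\<not> successively (\<lambda>u v. u \<rightarrow> v) (as @ v # a # bs)"
      proof
        assume "successively (\<lambda>u v. u \<rightarrow> v) (as @ v # a # bs)"
        then have "successively (\<lambda>u v. u \<rightarrow> v) ((as @ v # a # bs) @ y # zs)"
          using path(3) unfolding xs by (simp add: successively_append_iff)
        then have "dipath ((as @ v # a # bs) @ y # zs)"
          using path(1,2) v unfolding xs dipath_def by auto
        then show False
          using longest_dipath_maximal[OF longest, of "(as @ v # a # bs) @ y # zs"]
          unfolding xs by simp
      qed
    qed
    then show ?thesis using adj x by blast
  qed
  show "v \<rightarrow> z \<and> \<not> z \<rightarrow> v" if z: "z \<in> set zs"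
  proof -
    have "\<not> z \<rightarrow> v"
    proof (rule not_insertable_after[where E = "dominates G", OF parts(2) adj(2) _ z])
      fix as a bs
      assume zs: "zs = as @ a # bs"
      show "\<not> successively (\<lambda>u v. u \<rightarrow> v) (as @ a # v # bs)"
      proof
        assume "successively (\<lambda>u v. u \<rightarrow> v) (as @ a # v # bs)"
        then have "successively (\<lambda>u v. u \<rightarrow> v) ((xs @ [y]) @ as @ a # v # bs)"
          using path(3) unfolding zs
          by (cases as) (simp_all add: successively_append_iff successively_Cons)
        then have "dipath ((xs @ [y]) @ as @ a # v # bs)"
          using path(1,2) v unfolding zs dipath_def by auto
        then show False
          using longest_dipath_maximal[OF longest, of "(xs @ [y]) @ as @ a # v # bs"]
          unfolding zs by simp
      qed
    qed
    then show ?thesis using adj z by blast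
  qed
qed

lemma longest_dipath_exchange_twin:
  assumes longest: "longest_dipath (xs @ y # zs)"
    and v: "v \<in> verts G" "v \<notin> set (xs @ y # zs)"
    and nonadj: "\<not> (v \<rightarrow> y \<or> y \<rightarrow> v)"
  shows "longest_dipath (xs @ v # zs)"
proof -
  have path: "distinct (xs @ y # zs)" "set (xs @ y # zs) \<subseteq> verts G"
      "successively (\<lambda>u v. u \<rightarrow> v) (xs @ y # zs)"
    using longest by (auto simp: longest_dipath_def dipath_def)
  have "xs \<noteq> [] \<Longrightarrow> last xs \<rightarrow> v" "zs \<noteq> [] \<Longrightarrow> v \<rightarrow> hd zs"
    using twin_arcs[OF assms] by simp_all
  then have "successively (\<lambda>u v. u \<rightarrow> v) (xs @ v # zs)"
    using path(3) by (auto simp: successively_append_iff successively_Cons)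
  then have "dipath (xs @ v # zs)" using path(1,2) v by (simp add: dipath_def)
  then show ?thesis using longest by (simp add: longest_dipath_def)
qed

text \<open>
  With \<open>xs = as @ x # bs\<close> and \<open>zs = cs @ z # ds\<close>, an arc from \<open>z\<close> to \<open>x\<close> would give the path
  \<open>as, v, cs, z, x, bs, y, ds\<close>: it leaves out \<open>x, bs\<close> at first, since \<open>v\<close> follows every
  vertex of \<open>as\<close>, and uses \<open>y\<close> to skip over \<open>cs, z\<close> when it comes back.
\<close>

lemma no_arc_back_over_twins:
  assumes longest: "longest_dipath (xs @ y # zs)"
    and v: "v \<in> verts G" "v \<notin> set (xs @ y # zs)"
    and nonadj: "\<not> (v \<rightarrow> y \<or> y \<rightarrow> v)"
    and x: "x \<in> set xs" and z: "z \<in> set zs"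
  shows "\<not> z \<rightarrow> x"
proof
  assume back_arc: "z \<rightarrow> x"
  have path: "distinct (xs @ y # zs)" "set (xs @ y # zs) \<subseteq> verts G"
      "successively (\<lambda>u v. u \<rightarrow> v) (xs @ y # zs)"
    using longest by (auto simp: longest_dipath_def dipath_def)
  obtain as bs where xs: "xs = as @ x # bs" using x by (meson split_list)
  obtain cs ds where zs: "zs = cs @ z # ds" using z by (meson split_list)
  have v_arcs: "as \<noteq> [] \<Longrightarrow> last as \<rightarrow> v" "v \<rightarrow> hd (cs @ [z])"
    using twin_arcs[OF longest v nonadj] unfolding xs zs by (auto simp: hd_append)
  have y: "y \<in> verts G" "y \<notin> set (xs @ v # zs)" "\<not> (y \<rightarrow> v \<or> v \<rightarrow> y)"
    using path(1,2) v nonadj by auto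
  have y_arcs: "y \<rightarrow> hd ds" if "ds \<noteq> []"
    using twin_arcs(2)[OF longest_dipath_exchange_twin[OF longest v nonadj] y, of "hd ds"] that zs
    by simp
  have "successively (\<lambda>u v. u \<rightarrow> v) (as @ (x # bs @ [y]) @ (cs @ [z]) @ ds)"
    using path(3) unfolding xs zs by simp
  then have pieces: "successively (\<lambda>u v. u \<rightarrow> v) as" "successively (\<lambda>u v. u \<rightarrow> v) (x # bs @ [y])"
      "successively (\<lambda>u v. u \<rightarrow> v) (cs @ [z])" "successively (\<lambda>u v. u \<rightarrow> v) ds"
    unfolding successively_append_iff[of _ as] successively_append_iff[of _ "x # bs @ [y]"]
      successively_append_iff[of _ "cs @ [z]"] by blast+
  have "successively (\<lambda>u v. u \<rightarrow> v) (v # cs @ [z])"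
    using pieces(3) v_arcs(2) by (simp add: successively_Cons)
  moreover have "successively (\<lambda>u v. u \<rightarrow> v) ((x # bs @ [y]) @ ds)"
    unfolding successively_append_iff[of _ "x # bs @ [y]"] using pieces(2,4) y_arcs by auto
  ultimately have "successively (\<lambda>u v. u \<rightarrow> v) ((v # cs @ [z]) @ (x # bs @ [y]) @ ds)"
    unfolding successively_append_iff[of _ "v # cs @ [z]"] using back_arc by simp
  then have "successively (\<lambda>u v. u \<rightarrow> v) (as @ (v # cs @ [z]) @ (x # bs @ [y]) @ ds)"
    unfolding successively_append_iff[of _ as] using pieces(1) v_arcs(1) by auto
  then have "dipath (as @ (v # cs @ [z]) @ (x # bs @ [y]) @ ds)"
    using path(1,2) v unfolding xs zs by (auto simp: dipath_def)
  then show False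
    using longest_dipath_maximal[OF longest, of "as @ (v # cs @ [z]) @ (x # bs @ [y]) @ ds"]
    unfolding xs zs by simp
qed

text \<open>
  The position of a vertex \<open>u\<close> relative to the twins \<open>v\<close> and \<open>y\<close> is that of its own twin if \<open>u\<close> is
  off the path.  The exchange touches only one side of \<open>y\<close>, so that a vertex on the other side can
  be placed by a second exchange.
\<close>

lemma exchange_onto_path:
  assumes longest: "longest_dipath (xs @ y # zs)"
    and v: "v \<in> verts G" "v \<notin> set (xs @ y # zs)"
    and nonadj: "\<not> (v \<rightarrow> y \<or> y \<rightarrow> v)"
    and u: "u \<in> verts G" "u \<noteq> v" "u \<noteq> y"
  obtains (before) xs' where "longest_dipath (xs' @ y # zs)" "u \<in> set xs'"
      "v \<notin> set (xs' @ y # zs)"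
    | (after) zs' where "longest_dipath (xs @ y # zs')" "u \<in> set zs'" "v \<notin> set (xs @ y # zs')"
proof (cases "u \<in> set (xs @ y # zs)")
  case True
  then show ?thesis using that[of xs] that(2)[of zs] longest v u by auto
next
  case False
  then obtain t where t: "t \<in> set (xs @ y # zs)" "\<not> (u \<rightarrow> t \<or> t \<rightarrow> u)"
    using ex_nonneighbor_on_longest_dipath[OF longest] u by blast
  have "y \<in> verts G" using longest by (simp add: longest_dipath_def dipath_def)
  then have "t \<noteq> y" using unique_nonneighbor[of y u v] t u v nonadj by auto
  with t consider "t \<in> set xs" | "t \<in> set zs" by auto
  then show ?thesis
  proof cases
    case 1
    then obtain as bs where xs: "xs = as @ t # bs" by (meson split_list)
    have "longest_dipath (as @ u # bs @ y # zs)"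
      using longest_dipath_exchange_twin[of as t "bs @ y # zs" u] longest u False t xs by auto
    then show ?thesis using before[of "as @ u # bs"] v u xs by auto
  next
    case 2
    then obtain as bs where zs: "zs = as @ t # bs" by (meson split_list)
    have "longest_dipath (xs @ y # as @ u # bs)"
      using longest_dipath_exchange_twin[of "xs @ y # as" t bs u] longest u False t zs by auto
    then show ?thesis using after[of "as @ u # bs"] v u zs by auto
  qed
qed

text \<open>
  Suppose \<open>v\<close> did not dominate \<open>u\<close>.  An exchange on each side of \<open>y\<close> then puts \<open>u\<close> before and \<open>w\<close>
  after the twins on one longest path, and the arc from \<open>w\<close> to \<open>u\<close> would go back over them.
  That \<open>u\<close> is neither \<open>v\<close> nor \<open>y\<close> follows from the directions of the arcs at the twins.
\<close>

lemma out_neighborhood_of_twin_closed: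
  assumes longest: "longest_dipath (xs @ y # zs)"
    and v: "v \<in> verts G" "v \<notin> set (xs @ y # zs)"
    and nonadj: "\<not> (v \<rightarrow> y \<or> y \<rightarrow> v)"
    and "v \<rightarrow> w" "w \<rightarrow> u"
  shows "v \<rightarrow> u"
proof -
  have y: "y \<in> verts G" "y \<noteq> v"
    using longest v by (auto simp: longest_dipath_def dipath_def)
  have w: "w \<in> verts G" "w \<noteq> v" "w \<noteq> y"
    using \<open>v \<rightarrow> w\<close> nonadj adj_not_same by (auto dest: adj_in_verts)
  have not_into_twins: "\<not> w \<rightarrow> v" "\<not> w \<rightarrow> y"
  proof -
    have "\<not> w \<rightarrow> v \<and> \<not> w \<rightarrow> y"
      using longest v nonadj w
    proof (cases rule: exchange_onto_path)
      case (before xs')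
      then show ?thesis using twin_arcs(1)[OF before(1) v(1) before(3) nonadj] \<open>v \<rightarrow> w\<close> by blast
    next
      case (after zs')
      have "distinct (xs @ y # zs')"
        using after(1) by (simp add: longest_dipath_def dipath_def)
      then have "y \<notin> set (xs @ v # zs')" using y by auto
      then have "\<not> w \<rightarrow> y"
        using twin_arcs(2)[OF longest_dipath_exchange_twin[OF after(1) v(1) after(3) nonadj] y(1)]
          nonadj after(2) by blast
      then show ?thesis using twin_arcs(2)[OF after(1) v(1) after(3) nonadj after(2)] by blast
    qed
    then show "\<not> w \<rightarrow> v" "\<not> w \<rightarrow> y" by auto
  qed
  have u: "u \<in> verts G" "u \<noteq> v" "u \<noteq> y"
    using \<open>w \<rightarrow> u\<close> not_into_twins by (auto dest: adj_in_verts)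
  from longest v nonadj u show ?thesis
  proof (cases rule: exchange_onto_path)
    case u_before: (before xs')
    from u_before(1) v(1) u_before(3) nonadj w have False
    proof (cases rule: exchange_onto_path)
      case (before xs'')
      then show False using twin_arcs(1)[OF before(1) v(1) before(3) nonadj] \<open>v \<rightarrow> w\<close> by blast
    next
      case (after zs')
      then show False
        using no_arc_back_over_twins[OF after(1) v(1) after(3) nonadj u_before(2) after(2)]
          \<open>w \<rightarrow> u\<close> by blast
    qed
    then show ?thesis ..
  next
    case (after zs')
    then show ?thesis using twin_arcs(2)[OF after(1) v(1) after(3) nonadj] by blast
  qed
qed

lemma twin_not_reachable:
  assumes longest: "longest_dipath (xs @ y # zs)"
    and v: "v \<in> verts G" "v \<notin> set (xs @ y # zs)"
    and nonadj: "\<not> (v \<rightarrow> y \<or> y \<rightarrow> v)"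
  shows "\<not> v \<rightarrow>\<^sup>* y"
proof
  assume "v \<rightarrow>\<^sup>* y"
  then have "y = v \<or> v \<rightarrow> y"
    by (induction rule: reachable_induct)
      (use out_neighborhood_of_twin_closed[OF assms] in blast)+
  then show False using v nonadj by auto
qed

lemma longest_dipath_covers:
  assumes unilateral: "\<And>x y. x \<in> verts G \<Longrightarrow> y \<in> verts G \<Longrightarrow> x \<noteq> y \<Longrightarrow> x \<rightarrow>\<^sup>* y \<or> y \<rightarrow>\<^sup>* x"
    and longest: "longest_dipath p"
  shows "set p = verts G"
proof (rule ccontr)
  assume "set p \<noteq> verts G"
  moreover have "set p \<subseteq> verts G" using longest by (simp add: longest_dipath_def dipath_def)
  ultimately obtain v where v: "v \<in> verts G" "v \<notin> set p" by blast
  then obtain y where y: "y \<in> set p" "\<not> (v \<rightarrow> y \<or> y \<rightarrow> v)"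
    using ex_nonneighbor_on_longest_dipath[OF longest] by blast
  then obtain xs zs where p: "p = xs @ y # zs" by (meson split_list)
  have y_in: "y \<in> verts G" and dist: "distinct p"
    using longest y by (auto simp: longest_dipath_def dipath_def)
  have "\<not> v \<rightarrow>\<^sup>* y"
    using twin_not_reachable[OF longest[unfolded p]] v y(2) p by blast
  moreover have "\<not> y \<rightarrow>\<^sup>* v"
  proof (rule twin_not_reachable)
    show "longest_dipath (xs @ v # zs)"
      using longest_dipath_exchange_twin[OF longest[unfolded p]] v y(2) p by blast
  qed (use y_in y v dist in \<open>auto simp: p\<close>)
  ultimately show False using unilateral[OF v(1) y_in] v y by auto
qed

end

section \<open>Hamiltonian paths as arc walks\<close>

lemma (in wf_digraph) successively_imp_awalk:
  assumes "successively (\<lambda>u v. u \<rightarrow> v) xs" "xs \<noteq> []" "set xs \<subseteq> verts G"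
  shows "\<exists>p. awalk (hd xs) p (last xs) \<and> awalk_verts (hd xs) p = xs"
  using assms
proof (induction xs)
  case Nil
  then show ?case by simp
next
  case (Cons a xs)
  show ?case
  proof (cases "xs = []")
    case True
    then show ?thesis using Cons.prems by (intro exI[of _ "[]"]) (simp add: awalk_Nil_iff)
  next
    case False
    then obtain p where p: "awalk (hd xs) p (last xs)" "awalk_verts (hd xs) p = xs"
      using Cons by (auto simp: successively_Cons)
    have "a \<rightarrow> hd xs" using Cons.prems False by (simp add: successively_Cons)
    then obtain e where "e \<in> arcs G" "tail G e = a" "head G e = hd xs" by blast
    then show ?thesis
      using p False by (intro exI[of _ "e # p"]) (auto simp: awalk_Cons_iff)
  qed
qed

lemma (in wf_digraph) awalk_verts_unilateral:
  assumes "awalk u p v" "x \<in> set (awalk_verts u p)" "y \<in> set (awalk_verts u p)"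
  shows "x \<rightarrow>\<^sup>* y \<or> y \<rightarrow>\<^sup>* x"
proof -
  obtain q r where qr: "p = q @ r" "awalk u q x" "awalk x r v"
    using awalk_decomp[OF assms(1,2)] by blast
  then have "y \<in> set (awalk_verts u q) \<union> set (awalk_verts x r)"
    using assms(3) set_awalk_verts_append_cas[of u q x r v] by blast
  then show ?thesis
    using qr awalk_verts_reachable_from awalk_verts_reachable_to by blast
qed

section \<open>Semicomplete multipartite digraphs with independence number at most two\<close>

lemma (in fin_digraph) card_independent_le_independence_number:
  assumes "independent_set (with_proj (mk_symmetric G)) S"
  shows "card S \<le> independence_number G"
proof -
  have "{S. independent_set (with_proj (mk_symmetric G)) S} \<subseteq> Pow (verts G)"
    by (auto simp: independent_set_def)
  then have "finite {S. independent_set (with_proj (mk_symmetric G)) S}"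
    by (rule finite_subset) simp
  then show ?thesis
    using assms unfolding independence_number_def by (intro Max_ge) auto
qed

text \<open>
  Non-adjacency means lying in one color class, hence is transitive: two non-neighbors of a
  vertex would form an independent set of three vertices with it.
\<close>

lemma semicomplete_multipartite_imp_unique_nonneighbor:
  assumes smd: "semicomplete_multipartite D" and indep: "independence_number D \<le> 2"
  shows "unique_nonneighbor_digraph D"
proof -
  interpret digraph D using smd unfolding semicomplete_multipartite_def by blast
  obtain P where P: "partition_on (verts D) P"
    and adj_iff: "\<forall>u\<in>verts D. \<forall>v\<in>verts D. u \<noteq> v \<longrightarrow>
      (u \<rightarrow>\<^bsub>D\<^esub> v \<or> v \<rightarrow>\<^bsub>D\<^esub> u) \<longleftrightarrow> (\<exists>V\<in>P. \<exists>W\<in>P. V \<noteq> W \<and> u \<in> V \<and> v \<in> W)"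
    using smd unfolding semicomplete_multipartite_def by (elim conjE exE) (rule that)
  note adj = adj_iff[rule_format]
  have class_unique: "V = W" if "V \<in> P" "W \<in> P" "u \<in> V" "u \<in> W" for V W u
    using P that unfolding partition_on_def disjoint_def by blast
  show ?thesis
  proof unfold_locales
    fix x y z
    assume in_verts: "x \<in> verts D" "y \<in> verts D" "z \<in> verts D"
      and neq: "x \<noteq> y" "x \<noteq> z" "y \<noteq> z"
    show "(x \<rightarrow>\<^bsub>D\<^esub> y \<or> y \<rightarrow>\<^bsub>D\<^esub> x) \<or> (x \<rightarrow>\<^bsub>D\<^esub> z \<or> z \<rightarrow>\<^bsub>D\<^esub> x)"
    proof (rule ccontr)
      assume nonadj: "\<not> ?thesis"
      obtain V where V: "V \<in> P" "x \<in> V"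
        using P in_verts unfolding partition_on_def by blast
      obtain Y Z where YZ: "Y \<in> P" "y \<in> Y" "Z \<in> P" "z \<in> Z"
        using P in_verts unfolding partition_on_def by blast
      have "Y = V" "Z = V"
        using nonadj adj[of x y] adj[of x z] in_verts neq V YZ by blast+
      with YZ have "y \<in> V" "z \<in> V" by auto
      then have "\<not> (y \<rightarrow>\<^bsub>D\<^esub> z \<or> z \<rightarrow>\<^bsub>D\<^esub> y)"
        using adj[of y z] in_verts neq V class_unique by blast
      with nonadj have "independent_set (with_proj (mk_symmetric D)) {x, y, z}"
        using in_verts
        by (auto simp: independent_set_def parcs_mk_symmetric dest: in_arcs_imp_in_arcs_ends)
      then show False
        using card_independent_le_independence_number indep neq by fastforce
    qed
  qed
qed

theorem theorem4p6:
  fixes D :: "('a,'b) pre_digraph"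
  assumes "semicomplete_multipartite D"
    and "independence_number D \<le> 2"
  shows "unilaterally_connected D \<longleftrightarrow> (\<exists>u p v. hamiltonian_path D u p v)"
proof -
  interpret unique_nonneighbor_digraph D
    using assms by (rule semicomplete_multipartite_imp_unique_nonneighbor)
  show ?thesis
  proof
    assume unilateral: "unilaterally_connected D"
    obtain xs where longest: "longest_dipath xs" using longest_dipath_exists by blast
    have covers: "set xs = verts D"
      using unilateral longest
      by (intro longest_dipath_covers) (auto simp: unilaterally_connected_def reachable_apath)
    then have "xs \<noteq> []" using unilateral by (auto simp: unilaterally_connected_def)
    then obtain p where "awalk (hd xs) p (last xs)" "awalk_verts (hd xs) p = xs"
      using successively_imp_awalk[of xs] longest covers
      by (auto simp: longest_dipath_def dipath_def)
    then have "hamiltonian_path D (hd xs) p (last xs)"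
      using longest covers
      by (simp add: hamiltonian_path_def apath_def longest_dipath_def dipath_def)
    then show "\<exists>u p v. hamiltonian_path D u p v" by blast
  next
    assume "\<exists>u p v. hamiltonian_path D u p v"
    then obtain u p v where walk: "awalk u p v" and covers: "set (awalk_verts u p) = verts D"
      by (auto simp: hamiltonian_path_def apath_def)
    then have "verts D \<noteq> {}" by (metis awalk_verts_non_Nil set_empty)
    then show "unilaterally_connected D"
      using awalk_verts_unilateral[OF walk] covers
      by (simp add: unilaterally_connected_def flip: reachable_apath)
  qed
qed

end
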